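(* Let $\mathbf{k}$ be a field. Let $G$ be a group and let $\mathcal{A}:G\rightarrow G$ be an averaging operator on $G$. Then the map $\mathcal{A}$ can be uniquely extended to an averaging operator $B:\mathbf{k}[G]\rightarrow\mathbf{k}[G]$ on the group algebra $\mathbf{k}[G]$ viewed as a cocommutative Hopf algebra. Conversely, for any group $G$, if $B:\mathbf{k}[G]\rightarrow\mathbf{k}[G]$ is an averaging operator on the group algebra $\mathbf{k}[G]$, then $\mathcal{A}=B|_G$ is an averaging operator on the group $G$ (in particular, $B$ maps $G$ into $G$).
   Context: An averaging operator on a group $G$ is a map $\mathcal{A}:G\to G$ with $\mathcal{A}(g)\mathcal{A}(h)\mathcal{A}(g)^{-1} = \mathcal{A}(\mathcal{A}(g)h\mathcal{A}(g)^{-1})$ for all $g,h\in G$. An averaging operator on a cocommutative Hopf algebra $(H,\mu,\eta,\Delta,\epsilon,S)$ is a (linear) coalgebra map $B:H\to H$ (i.e. $\Delta\circ B=(B\otimes B)\circ\Delta$ and $\epsilon\circ B=\epsilon$) satisfying $B(x_{(1)})B(y)S(B(x_{(2)})) = B\big(B(x_{(1)})\,y\,S(B(x_{(2)}))\big)$ for all $x,y\in H$, in Sweedler notation $\Delta(x)=x_{(1)}\otimes x_{(2)}$. The group algebra $\mathbf{k}[G]$ has Hopf structure determined by $\Delta(g)=g\otimes g$, $\epsilon(g)=1$, $S(g)=g^{-1}$ for $g\in G$. *)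

theory Defs
  imports Complex_Main "HOL-Library.Poly_Mapping"
begin

section \<open>Formal linear combinations and linear extension\<close>

definition fscale :: "'k::field \<Rightarrow> ('a \<Rightarrow>\<^sub>0 'k) \<Rightarrow> ('a \<Rightarrow>\<^sub>0 'k)" where
  "fscale c u = Poly_Mapping.map ((*) c) u"

definition lin_ext :: "('k::field \<Rightarrow> 'v \<Rightarrow> 'v::ab_group_add) \<Rightarrow> ('a \<Rightarrow> 'v) \<Rightarrow> ('a \<Rightarrow>\<^sub>0 'k) \<Rightarrow> 'v" where
  "lin_ext scale f u = (\<Sum>a\<in>Poly_Mapping.keys u. scale (Poly_Mapping.lookup u a) (f a))"

abbreviation bas :: "'a \<Rightarrow> ('a \<Rightarrow>\<^sub>0 'k::field)" where
  "bas a \<equiv> Poly_Mapping.single a 1"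


section \<open>Tensor powers of a vector space\<close>

text \<open>
  The tensor product \<open>H \<otimes> H\<close> is the quotient of the vector space of formal linear combinations
  of pairs by the span of the bilinearity relations. A tensor is handled through
  a representing formal combination, and equality in \<open>H \<otimes> H\<close> is \<open>tensor_eq\<close>. The threefold tensor
  power is treated in the same way. In these types only the vector space structure of
  \<open>\<Rightarrow>\<^sub>0\<close> is used; in particular the convolution product is not the product of \<open>H \<otimes> H\<close>.
\<close>

definition tensor_rels :: "('k::field \<Rightarrow> 'h \<Rightarrow> 'h::ab_group_add) \<Rightarrow> ('h \<times> 'h \<Rightarrow>\<^sub>0 'k) set" where
  "tensor_rels scale =
     {bas (a + a', b) - bas (a, b) - bas (a', b) | a a' b. True} \<union>
     {bas (a, b + b') - bas (a, b) - bas (a, b') | a b b'. True} \<union>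
     {bas (scale c a, b) - fscale c (bas (a, b)) | c a b. True} \<union>
     {bas (a, scale c b) - fscale c (bas (a, b)) | c a b. True}"

definition tensor_eq ::
    "('k::field \<Rightarrow> 'h \<Rightarrow> 'h::ab_group_add) \<Rightarrow> ('h \<times> 'h \<Rightarrow>\<^sub>0 'k) \<Rightarrow> ('h \<times> 'h \<Rightarrow>\<^sub>0 'k) \<Rightarrow> bool" where
  "tensor_eq scale u v \<longleftrightarrow> u - v \<in> module.span fscale (tensor_rels scale)"

definition tensor3_rels :: "('k::field \<Rightarrow> 'h \<Rightarrow> 'h::ab_group_add) \<Rightarrow> ('h \<times> 'h \<times> 'h \<Rightarrow>\<^sub>0 'k) set" where
  "tensor3_rels scale =
     {bas (a + a', b, d) - bas (a, b, d) - bas (a', b, d) | a a' b d. True} \<union>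
     {bas (a, b + b', d) - bas (a, b, d) - bas (a, b', d) | a b b' d. True} \<union>
     {bas (a, b, d + d') - bas (a, b, d) - bas (a, b, d') | a b d d'. True} \<union>
     {bas (scale c a, b, d) - fscale c (bas (a, b, d)) | c a b d. True} \<union>
     {bas (a, scale c b, d) - fscale c (bas (a, b, d)) | c a b d. True} \<union>
     {bas (a, b, scale c d) - fscale c (bas (a, b, d)) | c a b d. True}"

definition tensor3_eq ::
    "('k::field \<Rightarrow> 'h \<Rightarrow> 'h::ab_group_add) \<Rightarrow> ('h \<times> 'h \<times> 'h \<Rightarrow>\<^sub>0 'k) \<Rightarrow> ('h \<times> 'h \<times> 'h \<Rightarrow>\<^sub>0 'k) \<Rightarrow> bool" where
  "tensor3_eq scale u v \<longleftrightarrow> u - v \<in> module.span fscale (tensor3_rels scale)"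

text \<open>\<open>tensor_map f f'\<close> is \<open>f \<otimes> f'\<close>, for linear maps \<open>f\<close> and \<open>f'\<close>.\<close>

definition tensor_map :: "('h \<Rightarrow> 'h) \<Rightarrow> ('h \<Rightarrow> 'h) \<Rightarrow> ('h \<times> 'h \<Rightarrow>\<^sub>0 'k::field) \<Rightarrow> ('h \<times> 'h \<Rightarrow>\<^sub>0 'k)" where
  "tensor_map f f' = lin_ext fscale (\<lambda>(a, b). bas (f a, f' b))"

definition tensor_swap :: "('h \<times> 'h \<Rightarrow>\<^sub>0 'k::field) \<Rightarrow> ('h \<times> 'h \<Rightarrow>\<^sub>0 'k)" where
  "tensor_swap = lin_ext fscale (\<lambda>(a, b). bas (b, a))"

text \<open>\<open>(a \<otimes> b) (a' \<otimes> b') = a a' \<otimes> b b'\<close>\<close>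

definition tensor_mult ::
    "('h::ring_1 \<times> 'h \<Rightarrow>\<^sub>0 'k::field) \<Rightarrow> ('h \<times> 'h \<Rightarrow>\<^sub>0 'k) \<Rightarrow> ('h \<times> 'h \<Rightarrow>\<^sub>0 'k)" where
  "tensor_mult u v =
     lin_ext fscale (\<lambda>(a, b). lin_ext fscale (\<lambda>(a', b'). bas (a * a', b * b')) v) u"

text \<open>For \<open>\<Delta> : H \<rightarrow> H \<otimes> H\<close>, the maps \<open>\<Delta> \<otimes> id\<close> and \<open>id \<otimes> \<Delta>\<close> from \<open>H \<otimes> H\<close> to \<open>H \<otimes> H \<otimes> H\<close>.\<close>

definition comult_left ::
    "('h \<Rightarrow> ('h \<times> 'h \<Rightarrow>\<^sub>0 'k::field)) \<Rightarrow> ('h \<times> 'h \<Rightarrow>\<^sub>0 'k) \<Rightarrow> ('h \<times> 'h \<times> 'h \<Rightarrow>\<^sub>0 'k)" where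
  "comult_left \<Delta> =
     lin_ext fscale (\<lambda>(a, b). lin_ext fscale (\<lambda>(a1, a2). bas (a1, a2, b)) (\<Delta> a))"

definition comult_right ::
    "('h \<Rightarrow> ('h \<times> 'h \<Rightarrow>\<^sub>0 'k::field)) \<Rightarrow> ('h \<times> 'h \<Rightarrow>\<^sub>0 'k) \<Rightarrow> ('h \<times> 'h \<times> 'h \<Rightarrow>\<^sub>0 'k)" where
  "comult_right \<Delta> =
     lin_ext fscale (\<lambda>(a, b). lin_ext fscale (\<lambda>(b1, b2). bas (a, b1, b2)) (\<Delta> b))"


section \<open>Cocommutative Hopf algebras and averaging operators\<close>

text \<open>
  \<open>sweedler \<Delta> f x\<close> is the Sweedler sum \<open>f x\<^sub>(\<^sub>1\<^sub>) x\<^sub>(\<^sub>2\<^sub>)\<close>. For bilinear \<open>f\<close>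
  it depends only on the class of \<open>\<Delta> x\<close> in \<open>H \<otimes> H\<close>.
\<close>

definition sweedler ::
    "('k::field \<Rightarrow> 'h \<Rightarrow> 'h::ab_group_add) \<Rightarrow> ('h \<Rightarrow> ('h \<times> 'h \<Rightarrow>\<^sub>0 'k)) \<Rightarrow> ('h \<Rightarrow> 'h \<Rightarrow> 'h) \<Rightarrow> 'h \<Rightarrow> 'h" where
  "sweedler scale \<Delta> f x = lin_ext scale (\<lambda>(a, b). f a b) (\<Delta> x)"

text \<open>The multiplication and unit of \<open>H\<close> are those of the type class \<open>ring_1\<close>.\<close>

locale cocommutative_hopf_algebra = vector_space scale
  for scale :: "'k::field \<Rightarrow> 'h::ring_1 \<Rightarrow> 'h" +
  fixes comult :: "'h \<Rightarrow> ('h \<times> 'h \<Rightarrow>\<^sub>0 'k)"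
    and counit :: "'h \<Rightarrow> 'k"
    and antipode :: "'h \<Rightarrow> 'h"
  assumes scale_mult_left: "scale c x * y = scale c (x * y)"
    and scale_mult_right: "x * scale c y = scale c (x * y)"
    and comult_add: "tensor_eq scale (comult (x + y)) (comult x + comult y)"
    and comult_scale: "tensor_eq scale (comult (scale c x)) (fscale c (comult x))"
    and comult_one: "tensor_eq scale (comult 1) (bas (1, 1))"
    and comult_mult: "tensor_eq scale (comult (x * y)) (tensor_mult (comult x) (comult y))"
    and counit_linear: "Vector_Spaces.linear scale (*) counit"
    and counit_one: "counit 1 = 1"
    and counit_mult: "counit (x * y) = counit x * counit y"
    and coassoc:
      "tensor3_eq scale (comult_left comult (comult x)) (comult_right comult (comult x))"
    and counit_left: "sweedler scale comult (\<lambda>a b. scale (counit a) b) x = x"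
    and counit_right: "sweedler scale comult (\<lambda>a b. scale (counit b) a) x = x"
    and antipode_linear: "Vector_Spaces.linear scale scale antipode"
    and antipode_left: "sweedler scale comult (\<lambda>a b. antipode a * b) x = scale (counit x) 1"
    and antipode_right: "sweedler scale comult (\<lambda>a b. a * antipode b) x = scale (counit x) 1"
    and cocommutative: "tensor_eq scale (tensor_swap (comult x)) (comult x)"

locale hopf_averaging_operator = cocommutative_hopf_algebra scale comult counit antipode
  for scale :: "'k::field \<Rightarrow> 'h::ring_1 \<Rightarrow> 'h"
    and comult :: "'h \<Rightarrow> ('h \<times> 'h \<Rightarrow>\<^sub>0 'k)"
    and counit :: "'h \<Rightarrow> 'k"
    and antipode :: "'h \<Rightarrow> 'h" +
  fixes B :: "'h \<Rightarrow> 'h"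
  assumes B_linear: "Vector_Spaces.linear scale scale B"
    and B_comult: "tensor_eq scale (comult (B x)) (tensor_map B B (comult x))"
    and B_counit: "counit (B x) = counit x"
    and B_averaging:
      "sweedler scale comult (\<lambda>x1 x2. B x1 * B y * antipode (B x2)) x =
       B (sweedler scale comult (\<lambda>x1 x2. B x1 * y * antipode (B x2)) x)"


section \<open>Groups and group algebras\<close>

text \<open>
  An arbitrary, not necessarily commutative, group is a type of class \<open>group_add\<close>: the group
  operation is written \<open>+\<close> and the inverse of \<open>g\<close> is \<open>- g\<close>. The group algebra of \<open>'g\<close> over \<open>'k\<close>
  is \<open>'g \<Rightarrow>\<^sub>0 'k\<close> with its convolution product, and \<open>bas g\<close> is the group element \<open>g\<close> in it.
\<close>

definition group_averaging_operator :: "('g::group_add \<Rightarrow> 'g) \<Rightarrow> bool" where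
  "group_averaging_operator A \<longleftrightarrow> (\<forall>g h. A g + A h + (- A g) = A (A g + h + (- A g)))"

definition grp_comult ::
    "('g::group_add \<Rightarrow>\<^sub>0 'k::field) \<Rightarrow> (('g \<Rightarrow>\<^sub>0 'k) \<times> ('g \<Rightarrow>\<^sub>0 'k) \<Rightarrow>\<^sub>0 'k)" where
  "grp_comult = lin_ext fscale (\<lambda>g. bas (bas g, bas g))"

definition grp_counit :: "('g::group_add \<Rightarrow>\<^sub>0 'k::field) \<Rightarrow> 'k" where
  "grp_counit = lin_ext (*) (\<lambda>g. 1)"

definition grp_antipode :: "('g::group_add \<Rightarrow>\<^sub>0 'k::field) \<Rightarrow> ('g \<Rightarrow>\<^sub>0 'k)" where
  "grp_antipode = lin_ext fscale (\<lambda>g. bas (- g))"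


section \<open>The group algebra is a cocommutative Hopf algebra\<close>

lemma lookup_fscale [simp]: "Poly_Mapping.lookup (fscale c u) a = c * Poly_Mapping.lookup u a"
  by (simp add: fscale_def Poly_Mapping.map.rep_eq when_def)

lemma vector_space_fscale: "vector_space (fscale :: 'k::field \<Rightarrow> ('a \<Rightarrow>\<^sub>0 'k) \<Rightarrow> _)"
  by unfold_locales (auto intro!: poly_mapping_eqI simp: lookup_add algebra_simps)

interpretation fs: vector_space "fscale :: 'k::field \<Rightarrow> ('a \<Rightarrow>\<^sub>0 'k) \<Rightarrow> _"
  by (rule vector_space_fscale)

lemma fscale_single: "fscale c (Poly_Mapping.single a d) = Poly_Mapping.single a (c * d)"
  by (rule poly_mapping_eqI) (simp add: lookup_single when_def)

lemma vector_space_field: "vector_space ((*) :: 'k::field \<Rightarrow> 'k \<Rightarrow> 'k)"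
  by unfold_locales (auto simp: algebra_simps)

lemma lin_ext_superset:
  assumes "vector_space scale" "finite S" "Poly_Mapping.keys u \<subseteq> S"
  shows "lin_ext scale f u = (\<Sum>a\<in>S. scale (Poly_Mapping.lookup u a) (f a))"
proof -
  interpret vector_space scale by fact
  show ?thesis unfolding lin_ext_def
    by (rule sum.mono_neutral_left) (use assms in \<open>auto simp: in_keys_iff\<close>)
qed

lemma linear_lin_ext:
  assumes "vector_space scale"
  shows "Vector_Spaces.linear fscale scale (lin_ext scale f)"
proof -
  interpret s: vector_space scale by fact
  show ?thesis
  proof unfold_locales
    fix u v :: "'c \<Rightarrow>\<^sub>0 'a"
    let ?S = "Poly_Mapping.keys u \<union> Poly_Mapping.keys v"
    have "Poly_Mapping.keys (u + v) \<subseteq> ?S" by (rule keys_add)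
    then show "lin_ext scale f (u + v) = lin_ext scale f u + lin_ext scale f v"
      by (simp add: lin_ext_superset[OF assms, of ?S] lookup_add s.scale_left_distrib sum.distrib)
  next
    fix c and u :: "'c \<Rightarrow>\<^sub>0 'a"
    have "Poly_Mapping.keys (fscale c u) \<subseteq> Poly_Mapping.keys u" by (auto simp: in_keys_iff)
    then show "lin_ext scale f (fscale c u) = scale c (lin_ext scale f u)"
      by (simp add: lin_ext_superset[OF assms, of "Poly_Mapping.keys u"] s.scale_sum_right)
  qed
qed

lemma lin_ext_bas: "vector_space scale \<Longrightarrow> lin_ext scale f (bas a) = f a"
proof -
  assume "vector_space scale"
  then interpret vector_space scale .
  show ?thesis by (simp add: lin_ext_def)
qed

lemma bas_expand: "u = lin_ext fscale bas u"
  by (rule poly_mapping_eqI)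
    (simp add: lin_ext_def lookup_sum lookup_single when_def in_keys_iff if_distrib cong: if_cong)

lemma linear_eq_bas:
  assumes "Vector_Spaces.linear fscale scale f" "Vector_Spaces.linear fscale scale f'"
    and "\<And>a. f (bas a) = f' (bas a)"
  shows "f u = f' u"
proof -
  interpret f: Vector_Spaces.linear fscale scale f by fact
  interpret f': Vector_Spaces.linear fscale scale f' by fact
  show ?thesis
    by (subst (1 2) bas_expand) (simp add: lin_ext_def f.sum f'.sum f.scale f'.scale assms(3))
qed

lemmas lin_ext_fs_bas [simp] = lin_ext_bas[OF vector_space_fscale]
lemmas lin_ext_field_bas [simp] = lin_ext_bas[OF vector_space_field]
lemmas linear_lin_ext_fs = linear_lin_ext[OF vector_space_fscale]
lemmas linear_lin_ext_field = linear_lin_ext[OF vector_space_field]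

lemma linear_id_fs: "Vector_Spaces.linear fscale fscale (\<lambda>x. x)"
  by unfold_locales auto

lemma linear_comp: "Vector_Spaces.linear s1 s2 f \<Longrightarrow> Vector_Spaces.linear s2 s3 f' \<Longrightarrow> Vector_Spaces.linear s1 s3 (\<lambda>x. f' (f x))"
  using Vector_Spaces.linear_compose[of s1 s2 f s3 f'] by (simp add: o_def)

lemma fscale_conv_mult: "fscale c x = Poly_Mapping.single 0 c * x"
  by (simp add: fscale_def mult_map_scale_conv_mult)

lemma fscale_mult_left: "fscale c x * y = fscale c (x * y :: 'g::group_add \<Rightarrow>\<^sub>0 'k::field)"
  by (simp add: fscale_conv_mult mult.assoc)

lemma fscale_mult_right: "x * fscale c y = fscale c (x * y :: 'g::group_add \<Rightarrow>\<^sub>0 'k::field)"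
proof -
  have "Vector_Spaces.linear fscale fscale (\<lambda>x :: 'g \<Rightarrow>\<^sub>0 'k. x * Poly_Mapping.single 0 c)"
    by unfold_locales (simp_all add: distrib_right fscale_mult_left)
  then have "x * Poly_Mapping.single 0 c = fscale c x" for x :: "'g \<Rightarrow>\<^sub>0 'k"
    by (rule linear_eq_bas) (unfold_locales, auto simp: fs.scale_right_distrib mult_single fscale_single mult.commute)
  then show ?thesis by (metis fscale_conv_mult mult.assoc)
qed

lemma linear_mult_left: "Vector_Spaces.linear fscale fscale (\<lambda>x :: 'g::group_add \<Rightarrow>\<^sub>0 'k::field. x * y)"
  by unfold_locales (simp_all add: distrib_right fscale_mult_left)

lemma linear_mult_right: "Vector_Spaces.linear fscale fscale (\<lambda>y :: 'g::group_add \<Rightarrow>\<^sub>0 'k::field. x * y)"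
  by unfold_locales (simp_all add: distrib_left fscale_mult_right)

lemma tensor_eq_refl: "tensor_eq scale u u"
  by (simp add: tensor_eq_def fs.span_zero)

lemma tensor3_eq_refl: "tensor3_eq scale u u"
  by (simp add: tensor3_eq_def fs.span_zero)

lemma linear_grp_comult: "Vector_Spaces.linear fscale fscale grp_comult"
  unfolding grp_comult_def by (rule linear_lin_ext_fs)

lemma linear_grp_counit: "Vector_Spaces.linear fscale (*) grp_counit"
  unfolding grp_counit_def by (rule linear_lin_ext_field)

lemma linear_grp_antipode: "Vector_Spaces.linear fscale fscale grp_antipode"
  unfolding grp_antipode_def by (rule linear_lin_ext_fs)

lemma grp_comult_bas [simp]: "grp_comult (bas g) = bas (bas g, bas g)"
  by (simp add: grp_comult_def)

lemma grp_counit_bas [simp]: "grp_counit (bas g) = 1"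
  by (simp add: grp_counit_def)

lemma grp_antipode_bas [simp]: "grp_antipode (bas g) = bas (- g)"
  by (simp add: grp_antipode_def)

lemma linear_sweedler: "Vector_Spaces.linear fscale fscale (sweedler fscale grp_comult f)"
  unfolding sweedler_def by (rule linear_comp[OF linear_grp_comult linear_lin_ext_fs])

lemma sweedler_bas [simp]: "sweedler fscale grp_comult f (bas g) = f (bas g) (bas g)"
  by (simp add: sweedler_def)

lemma linear_mult_bilinear_eq:
  fixes L R :: "('g::group_add \<Rightarrow>\<^sub>0 'k::field) \<Rightarrow> ('g \<Rightarrow>\<^sub>0 'k) \<Rightarrow> 'v::ab_group_add"
  assumes "\<And>y. Vector_Spaces.linear fscale s (\<lambda>x. L x y)" "\<And>y. Vector_Spaces.linear fscale s (\<lambda>x. R x y)"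
    "\<And>g. Vector_Spaces.linear fscale s (L (bas g))" "\<And>g. Vector_Spaces.linear fscale s (R (bas g))"
    "\<And>g h. L (bas g) (bas h) = R (bas g) (bas h)"
  shows "L x y = R x y"
proof -
  have "L (bas g) y = R (bas g) y" for g
    by (rule linear_eq_bas[OF assms(3) assms(4)]) (rule assms(5))
  then show ?thesis by (rule linear_eq_bas[OF assms(1) assms(2)])
qed

lemma tensor_mult_bas: "tensor_mult (bas p) v = lin_ext fscale (\<lambda>(a', b'). bas (fst p * a', snd p * b')) v"
  by (simp add: tensor_mult_def split: prod.split)

lemma grp_comult_mult:
  "grp_comult (x * y :: 'g::group_add \<Rightarrow>\<^sub>0 'k::field) = tensor_mult (grp_comult x) (grp_comult y)"
proof (rule linear_mult_bilinear_eq[where L = "\<lambda>x y. grp_comult (x * y)"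
      and R = "\<lambda>x y. tensor_mult (grp_comult x) (grp_comult y)"])
  fix y :: "'g \<Rightarrow>\<^sub>0 'k"
  show "Vector_Spaces.linear fscale fscale (\<lambda>x. grp_comult (x * y))"
    by (rule linear_comp[OF linear_mult_left linear_grp_comult])
  show "Vector_Spaces.linear fscale fscale (\<lambda>x. tensor_mult (grp_comult x) (grp_comult y))"
    unfolding tensor_mult_def by (rule linear_comp[OF linear_grp_comult linear_lin_ext_fs])
next
  fix g :: 'g
  show "Vector_Spaces.linear fscale fscale (\<lambda>y. grp_comult (bas g * y :: 'g \<Rightarrow>\<^sub>0 'k))"
    by (rule linear_comp[OF linear_mult_right linear_grp_comult])
  show "Vector_Spaces.linear fscale fscale (\<lambda>y. tensor_mult (grp_comult (bas g)) (grp_comult (y :: 'g \<Rightarrow>\<^sub>0 'k)))"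
    unfolding grp_comult_bas tensor_mult_bas
    by (rule linear_comp[OF linear_grp_comult linear_lin_ext_fs])
next
  fix g h :: 'g
  show "grp_comult (bas g * bas h :: 'g \<Rightarrow>\<^sub>0 'k) = tensor_mult (grp_comult (bas g)) (grp_comult (bas h))"
    by (simp add: mult_single tensor_mult_bas)
qed

lemma linear_field_mult_left: "Vector_Spaces.linear (*) (*) (\<lambda>x :: 'k::field. x * y)"
  and linear_field_mult_right: "Vector_Spaces.linear (*) (*) (\<lambda>y :: 'k::field. x * y)"
  by (unfold_locales; simp add: algebra_simps)+

lemma grp_counit_mult:
  "grp_counit (x * y :: 'g::group_add \<Rightarrow>\<^sub>0 'k::field) = grp_counit x * grp_counit y"
proof (rule linear_mult_bilinear_eq[where L = "\<lambda>x y. grp_counit (x * y)"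
      and R = "\<lambda>x y. grp_counit x * grp_counit y"])
  show "grp_counit (bas g * bas h :: 'g \<Rightarrow>\<^sub>0 'k) = grp_counit (bas g) * grp_counit (bas h)" for g h :: 'g
    by (simp add: mult_single)
qed (rule linear_comp[OF linear_mult_left linear_grp_counit]
    linear_comp[OF linear_mult_right linear_grp_counit]
    linear_comp[OF linear_grp_counit linear_field_mult_left]
    linear_comp[OF linear_grp_counit linear_field_mult_right])+

lemma linear_scale_one:
  "Vector_Spaces.linear (*) fscale (\<lambda>c. fscale c (v :: 'g::group_add \<Rightarrow>\<^sub>0 'k::field))"
  by unfold_locales (auto simp: fs.scale_left_distrib algebra_simps)

interpretation grp: cocommutative_hopf_algebra
  "fscale :: 'k::field \<Rightarrow> ('g::group_add \<Rightarrow>\<^sub>0 'k) \<Rightarrow> _" grp_comult grp_counit grp_antipode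
proof unfold_locales
  fix c :: 'k and x y :: "'g \<Rightarrow>\<^sub>0 'k"
  show "fscale c x * y = fscale c (x * y)" by (rule fscale_mult_left)
  show "x * fscale c y = fscale c (x * y)" by (rule fscale_mult_right)
  interpret cm: Vector_Spaces.linear fscale fscale "grp_comult :: ('g \<Rightarrow>\<^sub>0 'k) \<Rightarrow> _"
    by (rule linear_grp_comult)
  interpret cu: Vector_Spaces.linear fscale "(*)" "grp_counit :: ('g \<Rightarrow>\<^sub>0 'k) \<Rightarrow> _"
    by (rule linear_grp_counit)
  interpret ap: Vector_Spaces.linear fscale fscale "grp_antipode :: ('g \<Rightarrow>\<^sub>0 'k) \<Rightarrow> _"
    by (rule linear_grp_antipode)
  have one: "(1 :: 'g \<Rightarrow>\<^sub>0 'k) = bas 0" by simp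
  show "tensor_eq fscale (grp_comult (x + y)) (grp_comult x + grp_comult y)"
    by (simp add: cm.add tensor_eq_refl)
  show "tensor_eq fscale (grp_comult (fscale c x)) (fscale c (grp_comult x))"
    by (simp add: cm.scale tensor_eq_refl)
  show "tensor_eq fscale (grp_comult 1 :: ('g \<Rightarrow>\<^sub>0 'k) \<times> _ \<Rightarrow>\<^sub>0 'k) (bas (1, 1))"
    unfolding one grp_comult_bas by (rule tensor_eq_refl)
  show "tensor_eq fscale (grp_comult (x * y)) (tensor_mult (grp_comult x) (grp_comult y))"
    by (simp add: grp_comult_mult tensor_eq_refl)
  show "grp_counit (x + y) = grp_counit x + grp_counit y" by (rule cu.add)
  show "grp_counit (fscale c x) = c * grp_counit x" by (rule cu.scale)
  show "grp_counit (1 :: 'g \<Rightarrow>\<^sub>0 'k) = 1" unfolding one by (rule grp_counit_bas)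
  show "grp_counit (x * y) = grp_counit x * grp_counit y" by (rule grp_counit_mult)
  have "comult_left grp_comult (grp_comult x) = comult_right grp_comult (grp_comult x)"
    unfolding comult_left_def comult_right_def
    by (rule linear_eq_bas[OF linear_comp[OF linear_grp_comult linear_lin_ext_fs]
          linear_comp[OF linear_grp_comult linear_lin_ext_fs]]) simp
  then show "tensor3_eq fscale (comult_left grp_comult (grp_comult x)) (comult_right grp_comult (grp_comult x))"
    by (simp add: tensor3_eq_refl)
  show "sweedler fscale grp_comult (\<lambda>a b. fscale (grp_counit a) b) x = x"
    by (rule linear_eq_bas[OF linear_sweedler linear_id_fs]) simp
  show "sweedler fscale grp_comult (\<lambda>a b. fscale (grp_counit b) a) x = x"
    by (rule linear_eq_bas[OF linear_sweedler linear_id_fs]) simp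
  show "grp_antipode (x + y) = grp_antipode x + grp_antipode y" by (rule ap.add)
  show "grp_antipode (fscale c x) = fscale c (grp_antipode x)" by (rule ap.scale)
  show "sweedler fscale grp_comult (\<lambda>a b. grp_antipode a * b) x = fscale (grp_counit x) 1"
    by (rule linear_eq_bas[OF linear_sweedler linear_comp[OF linear_grp_counit linear_scale_one]])
      (simp add: mult_single)
  show "sweedler fscale grp_comult (\<lambda>a b. a * grp_antipode b) x = fscale (grp_counit x) 1"
    by (rule linear_eq_bas[OF linear_sweedler linear_comp[OF linear_grp_counit linear_scale_one]])
      (simp add: mult_single)
  have "tensor_swap (grp_comult x) = grp_comult x"
    unfolding tensor_swap_def
    by (rule linear_eq_bas[OF linear_comp[OF linear_grp_comult linear_lin_ext_fs] linear_grp_comult]) simp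
  then show "tensor_eq fscale (tensor_swap (grp_comult x)) (grp_comult x)"
    by (simp add: tensor_eq_refl)
qed (simp_all add: algebra_simps)

end

theory Submission
  imports Defs
begin

text \<open>
  Everything reduces to the basis \<open>G\<close> of \<open>k[G]\<close> by (bi)linearity, except that an averaging operator
  on \<open>k[G]\<close> maps \<open>G\<close> into \<open>G\<close>. This holds because a coalgebra map preserves group-like elements,
  i.e. \<open>u\<close> with \<open>\<Delta> u = u \<otimes> u\<close> and \<open>\<epsilon> u = 1\<close>, and the group-like elements of \<open>k[G]\<close> are exactly those
  of \<open>G\<close>: applying the product of the coordinate functionals at \<open>a\<close> and \<open>b\<close> to \<open>\<Delta> u = u \<otimes> u\<close> gives
  \<open>u\<^sub>a u\<^sub>b = \<delta>\<^sub>a\<^sub>b u\<^sub>a\<close>, so at most one coordinate is nonzero, and it equals \<open>1\<close>.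
\<close>

text \<open>A bilinear form, extended linearly to formal combinations of pairs, kills each of the
  four kinds of generators in \<open>tensor_rels\<close>, hence their span. It therefore descends to
  the tensor product, which turns an equality of tensors into equations in the field.\<close>

lemma tensor_eq_bilinear:
  fixes f :: "'h::ab_group_add \<Rightarrow> 'h \<Rightarrow> 'k::field"
  assumes eq: "tensor_eq scale u v"
    and "\<And>b. Vector_Spaces.linear scale (*) (\<lambda>a. f a b)"
    and "\<And>a. Vector_Spaces.linear scale (*) (f a)"
  shows "lin_ext (*) (\<lambda>(a, b). f a b) u = lin_ext (*) (\<lambda>(a, b). f a b) v"
proof -
  let ?F = "lin_ext (*) (\<lambda>(a, b). f a b)"
  interpret F: Vector_Spaces.linear fscale "(*)" ?F by (rule linear_lin_ext_field)
  have l: "module_hom scale (*) (\<lambda>a. f a b)" "module_hom scale (*) (f a)" for a b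
    using assms(2,3) by (simp_all add: module_hom_iff_linear)
  note simps = F.diff F.scale module_hom.add[OF l(1)] module_hom.add[OF l(2)]
    module_hom.scale[OF l(1)] module_hom.scale[OF l(2)]
  have "?F r = 0" if "r \<in> tensor_rels scale" for r
    using that unfolding tensor_rels_def by (auto simp: simps)
  moreover have "u - v \<in> fs.span (tensor_rels scale)"
    using eq by (simp add: tensor_eq_def)
  ultimately have "?F (u - v) = 0"
    using F.eq_0_on_span by blast
  then show ?thesis by (simp add: F.diff)
qed

lemma linear_lookup: "Vector_Spaces.linear fscale (*) (\<lambda>u. Poly_Mapping.lookup u a)"
  by unfold_locales (simp_all add: lookup_add algebra_simps)

text \<open>Both sides are linear in \<open>u\<close>, and at \<open>bas g\<close> both are 1 if
  \<open>g = a\<close> and \<open>g = b\<close>, and 0 otherwise. The given \<open>f'\<close>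
  presents the right-hand side as a linear map applied to the coordinate at
  \<open>a\<close>.\<close>

lemma grp_comult_coordinates:
  "lin_ext (*) (\<lambda>(p, q). Poly_Mapping.lookup p a * Poly_Mapping.lookup q b) (grp_comult u)
    = (if a = b then Poly_Mapping.lookup u a else 0)"
  by (rule linear_eq_bas[OF linear_comp[OF linear_grp_comult linear_lin_ext_field]
        linear_comp[OF linear_lookup, where f' = "\<lambda>c. if a = b then c else 0"]])
    (unfold_locales, auto simp: lookup_single when_def algebra_simps)

lemma group_like_is_bas:
  fixes u :: "'g::group_add \<Rightarrow>\<^sub>0 'k::field"
  assumes comult: "tensor_eq fscale (grp_comult u) (bas (u, u))"
    and counit: "grp_counit u = 1"
  shows "\<exists>a. u = bas a"
proof -
  have coord: "(if a = b then Poly_Mapping.lookup u a else 0)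
      = Poly_Mapping.lookup u a * Poly_Mapping.lookup u b" for a b
  proof -
    have "lin_ext (*) (\<lambda>(p, q). Poly_Mapping.lookup p a * Poly_Mapping.lookup q b) (grp_comult u)
      = lin_ext (*) (\<lambda>(p, q). Poly_Mapping.lookup p a * Poly_Mapping.lookup q b) (bas (u, u))"
      by (intro tensor_eq_bilinear[OF comult] linear_comp[OF linear_lookup]
          linear_field_mult_left linear_field_mult_right)
    then show ?thesis by (simp add: grp_comult_coordinates)
  qed
  \<comment> \<open>The zero vector also satisfies the comultiplication condition; the counit
    condition excludes it.\<close>
  have "u \<noteq> 0"
    using counit by (auto simp: grp_counit_def lin_ext_def)
  then obtain a where a: "Poly_Mapping.lookup u a \<noteq> 0"
    by (metis lookup_zero poly_mapping_eqI)
  have "Poly_Mapping.lookup u a = 1"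
    using coord[of a a] a by simp
  moreover have "Poly_Mapping.lookup u b = 0" if "b \<noteq> a" for b
    using coord[of a b] a that by simp
  ultimately have "u = bas a"
    by (intro poly_mapping_eqI) (auto simp: lookup_single when_def)
  then show ?thesis ..
qed

lemma hopf_averaging_operator_lin_ext:
  fixes A :: "'g::group_add \<Rightarrow> 'g"
  assumes A: "group_averaging_operator A"
  shows "hopf_averaging_operator fscale grp_comult grp_counit grp_antipode
    (lin_ext fscale (\<lambda>g. bas (A g)) :: ('g \<Rightarrow>\<^sub>0 'k::field) \<Rightarrow> _)"
proof -
  define B :: "('g \<Rightarrow>\<^sub>0 'k) \<Rightarrow> _" where "B = lin_ext fscale (\<lambda>g. bas (A g))"
  have lin: "Vector_Spaces.linear fscale fscale B"
    unfolding B_def by (rule linear_lin_ext_fs)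
  have B_bas [simp]: "B (bas g) = bas (A g)" for g
    by (simp add: B_def)
  \<comment> \<open>This is an equality of representatives, not just of tensors: at
    \<open>bas g\<close> both sides are \<open>bas (bas (A g), bas (A g))\<close>.\<close>
  have "grp_comult (B x) = tensor_map B B (grp_comult x)" for x
    unfolding tensor_map_def
    by (rule linear_eq_bas[OF linear_comp[OF lin linear_grp_comult]
          linear_comp[OF linear_grp_comult linear_lin_ext_fs]]) simp
  then have comult: "tensor_eq fscale (grp_comult (B x)) (tensor_map B B (grp_comult x))" for x
    by (simp add: tensor_eq_refl)
  have counit: "grp_counit (B x) = grp_counit x" for x
    by (rule linear_eq_bas[OF linear_comp[OF lin linear_grp_counit] linear_grp_counit]) simp
  have avg: "sweedler fscale grp_comult (\<lambda>x1 x2. B x1 * B y * grp_antipode (B x2)) x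
    = B (sweedler fscale grp_comult (\<lambda>x1 x2. B x1 * y * grp_antipode (B x2)) x)" for x y
  \<comment> \<open>A Sweedler sum is linear in \<open>x\<close> whatever its summand. Linearity in
    \<open>y\<close> is shown only at \<open>x = bas g\<close>, where the sum collapses to one term,
    a conjugation by \<open>bas (A g)\<close>.\<close>
  proof (rule linear_mult_bilinear_eq[where x = x and y = y and
      L = "\<lambda>x y. sweedler fscale grp_comult (\<lambda>x1 x2. B x1 * B y * grp_antipode (B x2)) x" and
      R = "\<lambda>x y. B (sweedler fscale grp_comult (\<lambda>x1 x2. B x1 * y * grp_antipode (B x2)) x)"])
    fix g h :: 'g
    have conj: "Vector_Spaces.linear fscale fscale (\<lambda>y. B (bas g) * y * grp_antipode (B (bas g)))"
      by (rule linear_comp[OF linear_mult_right linear_mult_left])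
    show "Vector_Spaces.linear fscale fscale
        (\<lambda>y. sweedler fscale grp_comult (\<lambda>x1 x2. B x1 * B y * grp_antipode (B x2)) (bas g))"
      unfolding sweedler_bas by (rule linear_comp[OF lin conj])
    show "Vector_Spaces.linear fscale fscale
        (\<lambda>y. B (sweedler fscale grp_comult (\<lambda>x1 x2. B x1 * y * grp_antipode (B x2)) (bas g)))"
      unfolding sweedler_bas by (rule linear_comp[OF conj lin])
    show "sweedler fscale grp_comult (\<lambda>x1 x2. B x1 * B (bas h) * grp_antipode (B x2)) (bas g)
      = B (sweedler fscale grp_comult (\<lambda>x1 x2. B x1 * bas h * grp_antipode (B x2)) (bas g))"
      using A by (simp add: mult_single group_averaging_operator_def)
  qed (rule linear_sweedler linear_comp[OF linear_sweedler lin])+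
  show ?thesis
    unfolding B_def[symmetric]
    by (intro hopf_averaging_operator.intro hopf_averaging_operator_axioms.intro
        grp.cocommutative_hopf_algebra_axioms lin comult counit avg)
qed

lemma hopf_averaging_operator_restrict:
  fixes B :: "('g::group_add \<Rightarrow>\<^sub>0 'k::field) \<Rightarrow> ('g \<Rightarrow>\<^sub>0 'k)"
  assumes "hopf_averaging_operator fscale grp_comult grp_counit grp_antipode B"
  shows "\<exists>A. (\<forall>g. B (bas g) = bas (A g)) \<and> group_averaging_operator A"
proof -
  interpret hopf_averaging_operator fscale grp_comult grp_counit grp_antipode B by fact
  \<comment> \<open>At \<open>bas g\<close> the coalgebra map axioms say exactly that
    \<open>B (bas g)\<close> is group-like.\<close>
  have "\<exists>a. B (bas g) = bas a" for g
    using B_comult[of "bas g"] B_counit[of "bas g"]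
    by (intro group_like_is_bas) (simp_all add: tensor_map_def)
  then obtain A where A: "\<And>g. B (bas g) = bas (A g)"
    by metis
  have "A g + A h + - A g = A (A g + h + - A g)" for g h
  proof -
    have "(bas (A g + A h + - A g) :: 'g \<Rightarrow>\<^sub>0 'k) = bas (A (A g + h + - A g))"
      using B_averaging[of "bas h" "bas g"] by (simp add: A mult_single)
    \<comment> \<open>Distinct group elements give distinct basis vectors, because 0 and 1 differ in
      the field.\<close>
    then show ?thesis
      by (metis lookup_single_eq lookup_single_not_eq zero_neq_one)
  qed
  with A show ?thesis
    unfolding group_averaging_operator_def by blast
qed

theorem theorem5p5:
  shows
    "(\<forall>A :: 'g::group_add \<Rightarrow> 'g. group_averaging_operator A \<longrightarrow>
        (\<exists>!B :: ('g \<Rightarrow>\<^sub>0 'k::field) \<Rightarrow> ('g \<Rightarrow>\<^sub>0 'k).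
            hopf_averaging_operator fscale grp_comult grp_counit grp_antipode B \<and>
            (\<forall>g. B (bas g) = bas (A g)))) \<and>
     (\<forall>B :: ('g \<Rightarrow>\<^sub>0 'k) \<Rightarrow> ('g \<Rightarrow>\<^sub>0 'k).
        hopf_averaging_operator fscale grp_comult grp_counit grp_antipode B \<longrightarrow>
        (\<exists>A :: 'g \<Rightarrow> 'g. (\<forall>g. B (bas g) = bas (A g)) \<and> group_averaging_operator A))"
proof (intro conjI allI impI)
  fix A :: "'g \<Rightarrow> 'g"
  assume A: "group_averaging_operator A"
  show "\<exists>!B :: ('g \<Rightarrow>\<^sub>0 'k) \<Rightarrow> ('g \<Rightarrow>\<^sub>0 'k).
      hopf_averaging_operator fscale grp_comult grp_counit grp_antipode B \<and>
      (\<forall>g. B (bas g) = bas (A g))"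
  proof (rule ex_ex1I)
    show "\<exists>B :: ('g \<Rightarrow>\<^sub>0 'k) \<Rightarrow> ('g \<Rightarrow>\<^sub>0 'k).
        hopf_averaging_operator fscale grp_comult grp_counit grp_antipode B \<and>
        (\<forall>g. B (bas g) = bas (A g))"
      using hopf_averaging_operator_lin_ext[OF A] by (intro exI conjI allI) auto
  next
    fix B B' :: "('g \<Rightarrow>\<^sub>0 'k) \<Rightarrow> ('g \<Rightarrow>\<^sub>0 'k)"
    assume B: "hopf_averaging_operator fscale grp_comult grp_counit grp_antipode B \<and>
        (\<forall>g. B (bas g) = bas (A g))"
      and B': "hopf_averaging_operator fscale grp_comult grp_counit grp_antipode B' \<and>
        (\<forall>g. B' (bas g) = bas (A g))"
    show "B = B'"
    proof (rule ext)
      \<comment> \<open>Both maps are linear and take the same values on the basis of group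
        elements.\<close>
      have "Vector_Spaces.linear fscale fscale B" "Vector_Spaces.linear fscale fscale B'"
        using B B' by (auto dest: hopf_averaging_operator.B_linear)
      then show "B u = B' u" for u
        by (rule linear_eq_bas) (use B B' in simp)
    qed
  qed
qed (rule hopf_averaging_operator_restrict)

end
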